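(* There are infinitely many pairwise non-isomorphic connected graphs $G$ with edge-connectivity $\kappa'(G)=1$ (that is, having a bridge) that admit an IRC-coloring.
   Context: Private neighbors. For $S\subseteq V(G)$ and $v\in S$, $pn[v,S]=N[v]\setminus\bigcup_{u\in S\setminus\{v\}}N[u]$, where $N[\cdot]$ is the closed neighborhood. $S$ is irredundant if $pn[v,S]\ne\emptyset$ for all $v\in S$. Rainbow committees and IRC-colorings. For a proper coloring of $G$ with nonempty color classes $V_1,\dots,V_k$, a rainbow committee is a set containing exactly one vertex of each color class. An irredundance compelling coloring (IRC-coloring) is a proper coloring in which every rainbow committee is an irredundant set. *)

theory Defs
  imports Main
begin

text \<open>Graphs are pairs of a vertex set and a set of two-element vertex sets.\<close>

type_synonym 'a graph = "'a set \<times> 'a set set"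

abbreviation verts :: "'a graph \<Rightarrow> 'a set" where
  "verts G \<equiv> fst G"

abbreviation edges :: "'a graph \<Rightarrow> 'a set set" where
  "edges G \<equiv> snd G"

definition simple_graph :: "'a graph \<Rightarrow> bool" where
  "simple_graph G \<longleftrightarrow> finite (verts G) \<and> (\<forall>e\<in>edges G. e \<subseteq> verts G \<and> card e = 2)"

definition graph_iso :: "'a graph \<Rightarrow> 'b graph \<Rightarrow> bool" where
  "graph_iso G H \<longleftrightarrow>
    (\<exists>f. bij_betw f (verts G) (verts H) \<and>
         (\<forall>u\<in>verts G. \<forall>v\<in>verts G. {u, v} \<in> edges G \<longleftrightarrow> {f u, f v} \<in> edges H))"

definition connected_graph :: "'a graph \<Rightarrow> bool" where
  "connected_graph G \<longleftrightarrow> verts G \<noteq> {} \<and>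
    (\<forall>u\<in>verts G. \<forall>v\<in>verts G. (u, v) \<in> {(x, y). {x, y} \<in> edges G}\<^sup>*)"

definition delete_edges :: "'a graph \<Rightarrow> 'a set set \<Rightarrow> 'a graph" where
  "delete_edges G F = (verts G, edges G - F)"

text \<open>
  The least number of edges whose deletion leaves a disconnected graph. The one-vertex graph has
  no disconnecting edge set and gets the conventional value 0.
\<close>

definition edge_connectivity :: "'a graph \<Rightarrow> nat" where
  "edge_connectivity G =
    (if card (verts G) = 1 then 0
     else Inf {card F | F. F \<subseteq> edges G \<and> \<not> connected_graph (delete_edges G F)})"

definition bridge :: "'a graph \<Rightarrow> 'a set \<Rightarrow> bool" where
  "bridge G e \<longleftrightarrow> e \<in> edges G \<and> \<not> connected_graph (delete_edges G {e})"

definition closed_nbhd :: "'a graph \<Rightarrow> 'a \<Rightarrow> 'a set" where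
  "closed_nbhd G v = insert v {u \<in> verts G. {u, v} \<in> edges G}"

definition private_nbrs :: "'a graph \<Rightarrow> 'a \<Rightarrow> 'a set \<Rightarrow> 'a set" where
  "private_nbrs G v S = closed_nbhd G v - (\<Union>u\<in>S - {v}. closed_nbhd G u)"

definition irredundant :: "'a graph \<Rightarrow> 'a set \<Rightarrow> bool" where
  "irredundant G S \<longleftrightarrow> S \<subseteq> verts G \<and> (\<forall>v\<in>S. private_nbrs G v S \<noteq> {})"

definition color_class :: "'a graph \<Rightarrow> ('a \<Rightarrow> nat) \<Rightarrow> nat \<Rightarrow> 'a set" where
  "color_class G c i = {v \<in> verts G. c v = i}"

text \<open>The image condition makes all color classes \<open>1, \<dots>, k\<close> nonempty.\<close>

definition proper_coloring :: "'a graph \<Rightarrow> nat \<Rightarrow> ('a \<Rightarrow> nat) \<Rightarrow> bool" where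
  "proper_coloring G k c \<longleftrightarrow> c ` verts G = {1..k} \<and>
    (\<forall>u\<in>verts G. \<forall>v\<in>verts G. {u, v} \<in> edges G \<longrightarrow> c u \<noteq> c v)"

definition rainbow_committee :: "'a graph \<Rightarrow> nat \<Rightarrow> ('a \<Rightarrow> nat) \<Rightarrow> 'a set \<Rightarrow> bool" where
  "rainbow_committee G k c S \<longleftrightarrow> S \<subseteq> verts G \<and>
    (\<forall>i\<in>{1..k}. \<exists>!v. v \<in> S \<inter> color_class G c i)"

definition IRC_coloring :: "'a graph \<Rightarrow> nat \<Rightarrow> ('a \<Rightarrow> nat) \<Rightarrow> bool" where
  "IRC_coloring G k c \<longleftrightarrow> proper_coloring G k c \<and>
    (\<forall>S. rainbow_committee G k c S \<longrightarrow> irredundant G S)"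

lemma edge_connectivity_eq_1_iff_bridge:
  assumes "simple_graph G" "connected_graph G"
  shows "edge_connectivity G = 1 \<longleftrightarrow> (\<exists>e. bridge G e)"
proof -
  define A where "A = {card F | F. F \<subseteq> edges G \<and> \<not> connected_graph (delete_edges G F)}"
  have "edges G \<subseteq> Pow (verts G)" "finite (verts G)"
    using assms(1) by (auto simp: simple_graph_def)
  then have fin: "finite (edges G)"
    by (meson finite_Pow_iff finite_subset)
  have "0 \<notin> A"
  proof
    assume "0 \<in> A"
    then obtain F where F: "card F = 0" "F \<subseteq> edges G" "\<not> connected_graph (delete_edges G F)"
      by (auto simp: A_def)
    then have "F = {}" using fin finite_subset by fastforce
    then show False using F(3) assms(2) by (simp add: delete_edges_def)
  qed
  have ec: "edge_connectivity G = Inf A" if "card (verts G) \<noteq> 1"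
    using that by (simp add: edge_connectivity_def A_def)
  have ne: "A \<noteq> {}" if card: "card (verts G) \<noteq> 1"
  proof -
    have "\<not> is_singleton (verts G)" "verts G \<noteq> {}"
      using card assms(2) by (auto simp: is_singleton_altdef connected_graph_def)
    then obtain u v where "u \<in> verts G" "v \<in> verts G" "u \<noteq> v"
      by (metis is_singletonI' ex_in_conv)
    then have "\<not> connected_graph (delete_edges G (edges G))"
      by (auto simp: connected_graph_def delete_edges_def)
    then show ?thesis unfolding A_def by blast
  qed
  show ?thesis
  proof
    assume "edge_connectivity G = 1"
    then have "card (verts G) \<noteq> 1" by (auto simp: edge_connectivity_def)
    with ec ne \<open>edge_connectivity G = 1\<close> have "1 \<in> A" using Inf_nat_def1[of A] by simp
    then obtain F where F: "card F = 1" "F \<subseteq> edges G" "\<not> connected_graph (delete_edges G F)"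
      by (auto simp: A_def)
    then obtain e where "F = {e}" by (auto simp: card_1_singleton_iff)
    with F show "\<exists>e. bridge G e" by (auto simp: bridge_def)
  next
    assume "\<exists>e. bridge G e"
    then obtain e where e: "{e} \<subseteq> edges G" "\<not> connected_graph (delete_edges G {e})"
      by (auto simp: bridge_def)
    then have "card {e} \<in> A" unfolding A_def by blast
    then have "1 \<in> A" by simp
    then have "Inf A \<le> 1" "Inf A \<in> A" by (auto intro: cInf_lower Inf_nat_def1)
    with \<open>0 \<notin> A\<close> have "Inf A = 1" by (metis le_neq_implies_less less_one)
    moreover have "card (verts G) \<noteq> 1"
    proof
      assume "card (verts G) = 1"
      then obtain x where "verts G = {x}" by (auto simp: card_1_singleton_iff)
      then have "connected_graph (delete_edges G {e})"
        by (simp add: connected_graph_def delete_edges_def)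
      with e show False by simp
    qed
    ultimately show "edge_connectivity G = 1" using ec by simp
  qed
qed

end

theory Submission
  imports Defs
begin

text \<open>
  In a bipartite graph without vertices of degree at most 1, the bipartition is an IRC-coloring:
  if a committee \<open>{a, b}\<close> is not independent, then any further neighbor of \<open>a\<close> lies in
  the same part as \<open>b\<close> and so is a private neighbor of \<open>a\<close>. It therefore suffices to join
  a 4-cycle by a bridge to complete bipartite graphs of increasing order.
\<close>

lemma IRC_coloring_bipartite:
  assumes proper: "proper_coloring G 2 c"
    and other_nbr: "\<And>u v. u \<in> verts G \<Longrightarrow> \<exists>w\<in>verts G. w \<noteq> v \<and> {u, w} \<in> edges G"
  shows "IRC_coloring G 2 c"
  unfolding IRC_coloring_def
proof (intro conjI allI impI)
  fix S
  assume rb: "rainbow_committee G 2 c S"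
  have SV: "S \<subseteq> verts G"
    using rb by (simp add: rainbow_committee_def)
  have col: "c v = 1 \<or> c v = 2" if "v \<in> verts G" for v
  proof -
    have "c v \<in> {1..2}"
      using proper that unfolding proper_coloring_def by blast
    then show ?thesis by auto
  qed
  have adj: "c u \<noteq> c v" if "u \<in> verts G" "v \<in> verts G" "{u, v} \<in> edges G" for u v
    using proper that unfolding proper_coloring_def by blast
  have inj: "u = v" if "u \<in> S" "v \<in> S" "c u = c v" for u v
  proof -
    have "c v \<in> {1..2}" using col[of v] subsetD[OF SV \<open>v \<in> S\<close>] by auto
    then have "\<exists>!w. w \<in> S \<inter> color_class G c (c v)"
      using rb unfolding rainbow_committee_def by blast
    moreover have "u \<in> S \<inter> color_class G c (c v)" "v \<in> S \<inter> color_class G c (c v)"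
      using that SV by (auto simp: color_class_def)
    ultimately show ?thesis by blast
  qed
  have "private_nbrs G v S \<noteq> {}" if v: "v \<in> S" for v
  proof (cases "\<exists>u\<in>S - {v}. {v, u} \<in> edges G")
    case False
    \<comment> \<open>With no neighbor inside \<open>S\<close>, the vertex \<open>v\<close> is its
      own private neighbor.\<close>
    then have "v \<in> private_nbrs G v S"
      by (auto simp: private_nbrs_def closed_nbhd_def)
    then show ?thesis by blast
  next
    case True
    then obtain u where u: "u \<in> S" "u \<noteq> v" "{v, u} \<in> edges G" by blast
    obtain w where w: "w \<in> verts G" "w \<noteq> u" "{v, w} \<in> edges G"
      using other_nbr v SV by blast
    have uvV: "u \<in> verts G" "v \<in> verts G" using u v SV by auto
    \<comment> \<open>Both \<open>w\<close> and \<open>u\<close> are adjacent to \<open>v\<close>,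
      and only one color differs from \<open>c v\<close>.\<close>
    have cw: "c w = c u"
      using col[of w] col[of u] col[of v] adj[of v u] adj[of v w] u w uvV by auto
    \<comment> \<open>With two colors, the only committee member besides \<open>v\<close> is
      \<open>u\<close>; it differs from \<open>w\<close> and, having the same color, is not adjacent
      to \<open>w\<close>.\<close>
    have "w \<notin> closed_nbhd G x" if x: "x \<in> S - {v}" for x
    proof -
      have "x \<in> verts G" using x SV by auto
      moreover have "c x \<noteq> c v" "c u \<noteq> c v" using inj x v u by blast+
      ultimately have "c x = c u"
        using col[of x] col[of u] col[of v] uvV by auto
      then have "x = u" using inj x u by blast
      then show ?thesis
        using adj[of w u] cw w uvV by (auto simp: closed_nbhd_def)
    qed
    moreover have "w \<in> closed_nbhd G v"
      using w by (auto simp: closed_nbhd_def insert_commute)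
    ultimately have "w \<in> private_nbrs G v S"
      by (simp add: private_nbrs_def)
    then show ?thesis by blast
  qed
  then show "irredundant G S"
    using SV by (simp add: irredundant_def)
qed (fact proper)

text \<open>Edges are unordered, so reachability is symmetric and any two vertices are linked
  through the root \<open>r\<close>.\<close>

lemma connected_graphI:
  assumes "r \<in> verts G"
    and "\<And>v. v \<in> verts G \<Longrightarrow> (v, r) \<in> {(x, y). {x, y} \<in> edges G}\<^sup>*"
  shows "connected_graph G"
proof -
  let ?R = "{(x, y). {x, y} \<in> edges G}"
  have "sym (?R\<^sup>*)"
    by (intro sym_rtrancl symI) (simp add: insert_commute)
  then have "(u, v) \<in> ?R\<^sup>*" if "u \<in> verts G" "v \<in> verts G" for u v
    using assms(2)[OF that(1)] assms(2)[OF that(2)] by (meson rtrancl_trans symD)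
  then show ?thesis
    unfolding connected_graph_def using assms(1) by blast
qed

text \<open>
  The vertices below 4 span the cycle 0, 1, 2, 3, the other ones a complete bipartite graph
  with parity classes as parts, and \<open>{3, 4}\<close> is the bridge.
\<close>

definition bridged :: "nat \<Rightarrow> nat graph" where
  "bridged n = ({..<n}, {{u, v} | u v. u < n \<and> v < n \<and> even u \<and> odd v \<and>
     ((u < 4 \<longleftrightarrow> v < 4) \<or> (u = 4 \<and> v = 3))})"

lemma verts_bridged [simp]: "verts (bridged n) = {..<n}"
  by (simp add: bridged_def)

text \<open>The definition lists every edge with its even end first; this form is symmetric in
  \<open>u\<close> and \<open>v\<close>, so it applies to either order of the ends.\<close>

lemma edge_bridged_iff:
  "{u, v} \<in> edges (bridged n) \<longleftrightarrow> u < n \<and> v < n \<and> (even u \<longleftrightarrow> odd v) \<and>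
     ((u < 4 \<longleftrightarrow> v < 4) \<or> {u, v} = {3, 4})"
  unfolding bridged_def by (auto simp: doubleton_eq_iff)

lemma simple_graph_bridged: "simple_graph (bridged n)"
  by (auto simp: simple_graph_def bridged_def card_insert_if)

lemma connected_graph_bridged:
  assumes "8 \<le> n"
  shows "connected_graph (bridged n)"
proof (rule connected_graphI)
  let ?R = "{(x, y). {x, y} \<in> edges (bridged n)}"
  show "4 \<in> verts (bridged n)" using assms by simp
  fix v assume v: "v \<in> verts (bridged n)"
  have step: "(x, 4) \<in> ?R\<^sup>*" if "{x, y} \<in> edges (bridged n)" "(y, 4) \<in> ?R\<^sup>*" for x y
    using that by (auto intro: converse_rtrancl_into_rtrancl)
  have three: "(3, 4) \<in> ?R\<^sup>*"
    using assms by (intro step[of 3 4]) (auto simp: edge_bridged_iff)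
  have zero: "(0, 4) \<in> ?R\<^sup>*"
    using assms by (intro step[OF _ three]) (auto simp: edge_bridged_iff)
  have five: "(5, 4) \<in> ?R\<^sup>*"
    using assms by (intro step[of 5 4]) (auto simp: edge_bridged_iff)
  \<comment> \<open>The routes to 4: even cycle vertices go through 3, odd ones through 0 and then
    3; beyond the bridge, even vertices go through 5 and odd ones are adjacent to 4.\<close>
  consider "v < 4" "even v" | "v < 4" "odd v" | "\<not> v < 4" "even v" | "\<not> v < 4" "odd v" by blast
  then show "(v, 4) \<in> ?R\<^sup>*"
  proof cases
    case 1
    then show ?thesis using assms v by (intro step[OF _ three]) (auto simp: edge_bridged_iff)
  next
    case 2
    then show ?thesis using assms v by (intro step[OF _ zero]) (auto simp: edge_bridged_iff)
  next
    case 3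
    then show ?thesis using assms v by (intro step[OF _ five]) (auto simp: edge_bridged_iff)
  next
    case 4
    then show ?thesis using assms v by (intro step[of v 4]) (auto simp: edge_bridged_iff)
  qed
qed

lemma bridge_bridged:
  assumes "8 \<le> n"
  shows "bridge (bridged n) {3, 4}"
  unfolding bridge_def
proof
  show "{3, 4} \<in> edges (bridged n)" using assms by (simp add: edge_bridged_iff)
  let ?D = "delete_edges (bridged n) {{3, 4}}"
  \<comment> \<open>Only the deleted edge crosses the threshold 4, so the vertices of the cycle are
    closed under reachability.\<close>
  have "y < 4" if "(x, y) \<in> {(x, y). {x, y} \<in> edges ?D}\<^sup>*" "x < 4" for x y
    using that by induction (auto simp: delete_edges_def edge_bridged_iff)
  from this[of 3 4] have "(3, 4) \<notin> {(x, y). {x, y} \<in> edges ?D}\<^sup>*" by auto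
  moreover have "3 \<in> verts ?D" "4 \<in> verts ?D"
    using assms by (auto simp: delete_edges_def)
  ultimately show "\<not> connected_graph ?D"
    unfolding connected_graph_def by blast
qed

lemma IRC_coloring_bridged:
  assumes "8 \<le> n"
  shows "IRC_coloring (bridged n) 2 (\<lambda>v. v mod 2 + 1)"
proof (rule IRC_coloring_bipartite)
  have "(\<lambda>v. v mod 2 + 1) ` {..<n} = {1..2}"
  proof
    show "{1..2} \<subseteq> (\<lambda>v. v mod 2 + 1) ` {..<n}"
    proof
      fix i :: nat assume "i \<in> {1..2}"
      then have "i = (i - 1) mod 2 + 1" "i - 1 \<in> {..<n}" using assms by auto
      then show "i \<in> (\<lambda>v. v mod 2 + 1) ` {..<n}" by blast
    qed
  qed auto
  then show "proper_coloring (bridged n) 2 (\<lambda>v. v mod 2 + 1)"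
    unfolding proper_coloring_def by (auto simp: edge_bridged_iff even_iff_mod_2_eq_zero)
next
  fix u v assume u: "u \<in> verts (bridged n)"
  \<comment> \<open>The two smallest vertices of opposite parity on the side of \<open>u\<close> are
    \<open>a\<close> and \<open>a + 2\<close>; both are neighbors of \<open>u\<close>, and at least
    one differs from \<open>v\<close>. The larger is at most 7, hence the bound 8 on
    \<open>n\<close>.\<close>
  define a where "a = (if u < 4 then 0 else 4) + (if even u then 1 else 0 :: nat)"
  have "{u, a} \<in> edges (bridged n)" "{u, a + 2} \<in> edges (bridged n)" "a + 2 < n"
    using u assms by (auto simp: a_def edge_bridged_iff)
  then show "\<exists>w\<in>verts (bridged n). w \<noteq> v \<and> {u, w} \<in> edges (bridged n)"
    by (cases "a = v") (auto intro: bexI[of _ a] bexI[of _ "a + 2"])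
qed

text \<open>The order of the graph recovers the index, and isomorphisms preserve the order.\<close>

lemma graph_iso_bridged_iff: "graph_iso (bridged m) (bridged n) \<longleftrightarrow> m = n"
proof
  assume "graph_iso (bridged m) (bridged n)"
  then show "m = n"
    by (auto simp: graph_iso_def dest: bij_betw_same_card)
next
  assume "m = n"
  then show "graph_iso (bridged m) (bridged n)"
    by (auto simp: graph_iso_def intro!: exI[of _ "\<lambda>v. v"] bij_betw_byWitness[of _ "\<lambda>v. v"])
qed

theorem theorem6:
  "\<exists>\<G> :: nat graph set. infinite \<G> \<and>
     (\<forall>G\<in>\<G>. \<forall>H\<in>\<G>. G \<noteq> H \<longrightarrow> \<not> graph_iso G H) \<and>
     (\<forall>G\<in>\<G>. simple_graph G \<and> connected_graph G \<and> edge_connectivity G = 1 \<and>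
        (\<exists>k c. IRC_coloring G k c))"
proof (intro exI[of _ "bridged ` {8..}"] conjI)
  \<comment> \<open>Each member is isomorphic to itself, so equal graphs have equal indices.\<close>
  have "inj bridged"
    by (metis graph_iso_bridged_iff injI)
  then show "infinite (bridged ` {8..})"
    by (metis finite_imageD infinite_Ici inj_on_subset subset_UNIV)
  show "\<forall>G\<in>bridged ` {8..}. \<forall>H\<in>bridged ` {8..}. G \<noteq> H \<longrightarrow> \<not> graph_iso G H"
    by (auto simp: graph_iso_bridged_iff)
  show "\<forall>G\<in>bridged ` {8..}. simple_graph G \<and> connected_graph G \<and> edge_connectivity G = 1 \<and>
      (\<exists>k c. IRC_coloring G k c)"
  proof
    fix G assume "G \<in> bridged ` {8..}"
    then obtain n where n: "8 \<le> n" and G: "G = bridged n" by auto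
    have "edge_connectivity G = 1"
      unfolding G using bridge_bridged[OF n]
      by (subst edge_connectivity_eq_1_iff_bridge[OF simple_graph_bridged connected_graph_bridged[OF n]])
        (rule exI)
    then show "simple_graph G \<and> connected_graph G \<and> edge_connectivity G = 1 \<and>
        (\<exists>k c. IRC_coloring G k c)"
      unfolding G
      using simple_graph_bridged connected_graph_bridged[OF n] IRC_coloring_bridged[OF n] by blast
  qed
qed

end
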